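(* There is no Hopf monoid morphism $\phi:\overline{\mathbf{Pos}}\Rightarrow\overline{\mathbf{GP}}$ that preserves the corresponding characters, i.e. such that $\eta_{\overline{\mathbf{GP}}}\circ\phi=\eta_{\overline{\mathbf{Pos}}}$.
   Context: $\mathbb{K}$ is a field of characteristic zero. A (vector) species is a functor from finite sets with bijections to $\mathbb{K}$-vector spaces; Hopf monoids in species are taken with respect to the Cauchy product $(\overline{a}\cdot\overline{b})[I]=\bigoplus_{I=S\sqcup T}\overline{a}[S]\otimes\overline{b}[T]$. Their products and coproducts are given by natural maps $\mu_{A,B}:\overline{h}[A]\otimes\overline{h}[B]\to\overline{h}[A\sqcup B]$ and $\Delta_{A,B}:\overline{h}[A\sqcup B]\to\overline{h}[A]\otimes\overline{h}[B]$. Hopf monoid morphisms are natural transformations compatible with products, coproducts, units and counits. $\overline{\mathbf{Pos}}$: $\overline{\mathbf{Pos}}[I]$ has basis the partial orders on $I$, with bijections acting by relabelling. The product of $P$ on $A$ and $Q$ on $B$ is the disjoint union $P\sqcup Q$ (no relations between $A$ and $B$). The coproduct is $\Delta_{A,B}(P)=P|_A\otimes P|_B$ if $A$ is an ideal of $P$, meaning $x\in A$ and $x\le_P y$ imply $y\in A$; otherwise $\Delta_{A,B}(P)=0$. The unit is the empty poset, and the counit is $1$ on the empty poset. The character is $\eta_{\overline{\mathbf{Pos}}}(P)=1$ if $P$ is an antichain, $0$ otherwise. $\overline{\mathbf{GP}}$: for non-empty $J\subseteq I$ let $\mathfrak{s}_J=\mathrm{conv}\{e_j:j\in J\}\subseteq\mathbb{R}^I$.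 A generalized permutahedron in $\mathbb{R}^I$ is a polytope of the form $\mathfrak{q}=\big(\sum_{a_J>0}a_J\mathfrak{s}_J\big)-\big(\sum_{a_J<0}|a_J|\mathfrak{s}_J\big)$ for reals $\{a_J\}_{\emptyset\neq J\subseteq I}$ for which the Minkowski difference exists (where $\mathfrak{a}-\mathfrak{b}$ is the unique polytope $\mathfrak{c}$ with $\mathfrak{b}+\mathfrak{c}=\mathfrak{a}$; empty Minkowski sums are $\{0\}$). $\overline{\mathbf{GP}}[I]$ has basis the generalized permutahedra in $\mathbb{R}^I$, with bijections acting by relabelling coordinates. The product is $\mathfrak{q}_1\cdot\mathfrak{q}_2=\mathfrak{q}_1\times\mathfrak{q}_2\subseteq\mathbb{R}^{A\sqcup B}$. The coproduct is $\Delta_{A,B}(\mathfrak{q})=\mathfrak{q}|_A\otimes\mathfrak{q}\backslash_A$, where $\mathfrak{q}|_A\subseteq\mathbb{R}^A$ and $\mathfrak{q}\backslash_A\subseteq\mathbb{R}^B$ are $$\mathfrak{q}|_A=\Big(\sum_{a_J>0,\,J\not\subseteq B}a_J\mathfrak{s}_{J\cap A}\Big)-\Big(\sum_{a_J<0,\,J\not\subseteq B}|a_J|\mathfrak{s}_{J\cap A}\Big),\qquad \mathfrak{q}\backslash_A=\Big(\sum_{a_J>0,\,J\subseteq B}a_J\mathfrak{s}_J\Big)-\Big(\sum_{a_J<0,\,J\subseteq B}|a_J|\mathfrak{s}_J\Big);$$ equivalently, $\mathfrak{q}|_A\times\mathfrak{q}\backslash_A$ is the face of $\mathfrak{q}$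 minimizing $\sum_i f(i)x_i$ for any $f$ that is constant on $A$, constant on $B$, and smaller on $A$ than on $B$. The unit is the unique point polytope in $\mathbb{R}^\emptyset$, and the counit is $1$ on it. The character is $\eta_{\overline{\mathbf{GP}}}(\mathfrak{q})=1$ if $\mathfrak{q}$ is a point, $0$ otherwise. *)

theory Defs
  imports
    "HOL-Analysis.Analysis"
    "HOL-Library.Function_Algebras"
    "HOL-Library.Set_Algebras"
    "HOL-Library.Poly_Mapping"
    "HOL-Library.Infinite_Typeclass"
begin

section \<open>Free vector spaces\<close>

text \<open>
  The vector space with basis \<open>B\<close> consists of the finitely supported functions whose support
  lies in \<open>B\<close>; the basis vector of \<open>b \<in> B\<close> is \<open>Poly_Mapping.single b 1\<close>. The tensor product of
  the spaces with bases \<open>B\<close> and \<open>C\<close> is the space with basis \<open>B \<times> C\<close>, where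
  \<open>u \<otimes> v\<close> is \<open>tensor u v\<close>.
\<close>

definition vspace :: "'b set \<Rightarrow> ('b \<Rightarrow>\<^sub>0 'k::field) set" where
  "vspace B = {v. Poly_Mapping.keys v \<subseteq> B}"

definition scale_vec :: "'k::field \<Rightarrow> ('b \<Rightarrow>\<^sub>0 'k) \<Rightarrow> ('b \<Rightarrow>\<^sub>0 'k)" where
  "scale_vec c v = Poly_Mapping.map ((*) c) v"

definition lin_ext :: "('b \<Rightarrow> ('c \<Rightarrow>\<^sub>0 'k::field)) \<Rightarrow> ('b \<Rightarrow>\<^sub>0 'k) \<Rightarrow> ('c \<Rightarrow>\<^sub>0 'k)" where
  "lin_ext f v = (\<Sum>b\<in>Poly_Mapping.keys v. scale_vec (Poly_Mapping.lookup v b) (f b))"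

definition lin_form :: "('b \<Rightarrow> 'k::field) \<Rightarrow> ('b \<Rightarrow>\<^sub>0 'k) \<Rightarrow> 'k" where
  "lin_form f v = (\<Sum>b\<in>Poly_Mapping.keys v. Poly_Mapping.lookup v b * f b)"

definition linear_between ::
  "('b \<Rightarrow>\<^sub>0 'k::field) set \<Rightarrow> ('c \<Rightarrow>\<^sub>0 'k) set \<Rightarrow> (('b \<Rightarrow>\<^sub>0 'k) \<Rightarrow> ('c \<Rightarrow>\<^sub>0 'k)) \<Rightarrow> bool" where
  "linear_between V W f \<longleftrightarrow>
     (\<forall>v\<in>V. f v \<in> W) \<and>
     (\<forall>v\<in>V. \<forall>w\<in>V. f (v + w) = f v + f w) \<and>
     (\<forall>c. \<forall>v\<in>V. f (scale_vec c v) = scale_vec c (f v))"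

definition tensor :: "('b \<Rightarrow>\<^sub>0 'k::field) \<Rightarrow> ('c \<Rightarrow>\<^sub>0 'k) \<Rightarrow> ('b \<times> 'c \<Rightarrow>\<^sub>0 'k)" where
  "tensor u v = (\<Sum>b\<in>Poly_Mapping.keys u. \<Sum>c\<in>Poly_Mapping.keys v.
     Poly_Mapping.single (b, c) (Poly_Mapping.lookup u b * Poly_Mapping.lookup v c))"

text \<open>The tensor product \<open>f \<otimes> g\<close> of two linear maps, given on basis vectors.\<close>

definition tensor_map ::
  "(('b \<Rightarrow>\<^sub>0 'k::field) \<Rightarrow> ('d \<Rightarrow>\<^sub>0 'k)) \<Rightarrow> (('c \<Rightarrow>\<^sub>0 'k) \<Rightarrow> ('e \<Rightarrow>\<^sub>0 'k)) \<Rightarrow>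
   ('b \<times> 'c \<Rightarrow>\<^sub>0 'k) \<Rightarrow> ('d \<times> 'e \<Rightarrow>\<^sub>0 'k)" where
  "tensor_map f g =
     lin_ext (\<lambda>(b, c). tensor (f (Poly_Mapping.single b 1)) (g (Poly_Mapping.single c 1)))"


section \<open>Hopf monoids in species with chosen bases\<close>

text \<open>
  Finite sets are the finite subsets of a label type \<open>'a\<close>, which is assumed infinite where this
  matters. Every component is meaningful for finite sets of labels only:
  \<^item> the value of the species on \<open>I\<close> is \<open>vspace (basis H I)\<close>;
  \<^item> \<open>act H \<sigma> I\<close> is the map induced by the bijection \<open>\<sigma> : I \<rightarrow> \<sigma> ` I\<close>;
  \<^item> \<open>mult H A B\<close> and \<open>comult H A B\<close>, for disjoint \<open>A\<close> and \<open>B\<close>, are the structure maps between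
    \<open>vspace (basis H A \<times> basis H B)\<close> and \<open>vspace (basis H (A \<union> B))\<close>;
  \<^item> \<open>unit H\<close> and \<open>counit H\<close> live on \<open>vspace (basis H {})\<close>, because the unit species vanishes on
    non-empty sets.
\<close>

record (overloaded) ('a, 'b, 'k) hopf_data =
  basis :: "'a set \<Rightarrow> 'b set"
  act :: "('a \<Rightarrow> 'a) \<Rightarrow> 'a set \<Rightarrow> ('b \<Rightarrow>\<^sub>0 'k) \<Rightarrow> ('b \<Rightarrow>\<^sub>0 'k)"
  mult :: "'a set \<Rightarrow> 'a set \<Rightarrow> ('b \<times> 'b \<Rightarrow>\<^sub>0 'k) \<Rightarrow> ('b \<Rightarrow>\<^sub>0 'k)"
  comult :: "'a set \<Rightarrow> 'a set \<Rightarrow> ('b \<Rightarrow>\<^sub>0 'k) \<Rightarrow> ('b \<times> 'b \<Rightarrow>\<^sub>0 'k)"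
  unit :: "'b \<Rightarrow>\<^sub>0 'k"
  counit :: "('b \<Rightarrow>\<^sub>0 'k) \<Rightarrow> 'k"

definition hopf_morphism ::
  "('a, 'b, 'k::field) hopf_data \<Rightarrow> ('a, 'c, 'k) hopf_data \<Rightarrow>
   ('a set \<Rightarrow> ('b \<Rightarrow>\<^sub>0 'k) \<Rightarrow> ('c \<Rightarrow>\<^sub>0 'k)) \<Rightarrow> bool" where
  "hopf_morphism H K \<phi> \<longleftrightarrow>
     (\<forall>I. finite I \<longrightarrow> linear_between (vspace (basis H I)) (vspace (basis K I)) (\<phi> I)) \<and>
     (\<forall>I J \<sigma> v. finite I \<longrightarrow> bij_betw \<sigma> I J \<longrightarrow> v \<in> vspace (basis H I) \<longrightarrow>
        \<phi> J (act H \<sigma> I v) = act K \<sigma> I (\<phi> I v)) \<and>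
     (\<forall>A B w. finite A \<longrightarrow> finite B \<longrightarrow> A \<inter> B = {} \<longrightarrow> w \<in> vspace (basis H A \<times> basis H B) \<longrightarrow>
        \<phi> (A \<union> B) (mult H A B w) = mult K A B (tensor_map (\<phi> A) (\<phi> B) w)) \<and>
     (\<forall>A B v. finite A \<longrightarrow> finite B \<longrightarrow> A \<inter> B = {} \<longrightarrow> v \<in> vspace (basis H (A \<union> B)) \<longrightarrow>
        tensor_map (\<phi> A) (\<phi> B) (comult H A B v) = comult K A B (\<phi> (A \<union> B) v)) \<and>
     \<phi> {} (unit H) = unit K \<and>
     (\<forall>v \<in> vspace (basis H {}). counit K (\<phi> {} v) = counit H v)"


section \<open>The Hopf monoid of posets\<close>

text \<open>A poset is the set of pairs \<open>(x, y)\<close> with \<open>x \<le> y\<close>, the diagonal of its ground set included.\<close>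

definition poset_ideal :: "'a rel \<Rightarrow> 'a set \<Rightarrow> bool" where
  "poset_ideal P A \<longleftrightarrow> (\<forall>x y. x \<in> A \<longrightarrow> (x, y) \<in> P \<longrightarrow> y \<in> A)"

definition Pos :: "('a, 'a rel, 'k::field_char_0) hopf_data" where
  "Pos = \<lparr>
     basis = (\<lambda>I. {P. partial_order_on I P}),
     act = (\<lambda>\<sigma> I. lin_ext (\<lambda>P. Poly_Mapping.single (map_prod \<sigma> \<sigma> ` P) 1)),
     mult = (\<lambda>A B. lin_ext (\<lambda>(P, Q). Poly_Mapping.single (P \<union> Q) 1)),
     comult = (\<lambda>A B. lin_ext (\<lambda>P.
        if poset_ideal P A
        then Poly_Mapping.single (P \<inter> A \<times> A, P \<inter> B \<times> B) 1
        else 0)),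
     unit = Poly_Mapping.single {} 1,
     counit = lin_form (\<lambda>P. if P = {} then 1 else 0) \<rparr>"

definition Pos_character :: "'a set \<Rightarrow> ('a rel \<Rightarrow>\<^sub>0 'k::field_char_0) \<Rightarrow> 'k" where
  "Pos_character I = lin_form (\<lambda>P. if (\<forall>x y. (x, y) \<in> P \<longrightarrow> x = y) then 1 else 0)"


section \<open>The Hopf monoid of generalized permutahedra\<close>

instantiation "fun" :: (type, real_vector) real_vector
begin

definition scaleR_fun :: "real \<Rightarrow> ('a \<Rightarrow> 'b) \<Rightarrow> 'a \<Rightarrow> 'b" where
  "scaleR_fun c f = (\<lambda>i. c *\<^sub>R f i)"

instance
  by standard (auto simp: scaleR_fun_def fun_eq_iff scaleR_add_right scaleR_add_left)

end

text \<open>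
  The space \<open>\<real>\<^sup>I\<close> is the set of functions \<open>'a \<Rightarrow> real\<close> that vanish outside \<open>I\<close>. Minkowski addition
  is the addition of sets, so that an empty sum is \<open>0 = {0}\<close>.
\<close>

definition basis_vec :: "'a \<Rightarrow> 'a \<Rightarrow> real" where
  "basis_vec j = (\<lambda>i. if i = j then 1 else 0)"

definition simplex_on :: "'a set \<Rightarrow> ('a \<Rightarrow> real) set" where
  "simplex_on J = convex hull (basis_vec ` J)"

definition dilate :: "real \<Rightarrow> ('a \<Rightarrow> real) set \<Rightarrow> ('a \<Rightarrow> real) set" where
  "dilate c S = (\<lambda>x. c *\<^sub>R x) ` S"

definition is_minkowski_diff ::
  "('a \<Rightarrow> real) set \<Rightarrow> ('a \<Rightarrow> real) set \<Rightarrow> ('a \<Rightarrow> real) set \<Rightarrow> bool" where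
  "is_minkowski_diff p n q \<longleftrightarrow> polytope q \<and> n + q = p"

definition minkowski_diff :: "('a \<Rightarrow> real) set \<Rightarrow> ('a \<Rightarrow> real) set \<Rightarrow> ('a \<Rightarrow> real) set" where
  "minkowski_diff p n = (THE q. is_minkowski_diff p n q)"

text \<open>
  The positive and negative parts of \<open>\<Sum>J\<in>\<J>. a\<^sub>J \<s>\<^bsub>g J\<^esub>\<close>, where \<open>\<s>\<^sub>J\<close> denotes the simplex \<open>simplex_on J\<close>.
  The reindexing \<open>g\<close> is needed for the coproduct.
\<close>

definition pos_part :: "'a set set \<Rightarrow> ('a set \<Rightarrow> 'a set) \<Rightarrow> ('a set \<Rightarrow> real) \<Rightarrow> ('a \<Rightarrow> real) set" where
  "pos_part \<J> g a = (\<Sum>J\<in>{J\<in>\<J>. a J > 0}. dilate (a J) (simplex_on (g J)))"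

definition neg_part :: "'a set set \<Rightarrow> ('a set \<Rightarrow> 'a set) \<Rightarrow> ('a set \<Rightarrow> real) \<Rightarrow> ('a \<Rightarrow> real) set" where
  "neg_part \<J> g a = (\<Sum>J\<in>{J\<in>\<J>. a J < 0}. dilate \<bar>a J\<bar> (simplex_on (g J)))"

definition gp_coeffs :: "'a set \<Rightarrow> ('a set \<Rightarrow> real) \<Rightarrow> ('a \<Rightarrow> real) set \<Rightarrow> bool" where
  "gp_coeffs I a q \<longleftrightarrow>
     is_minkowski_diff (pos_part (Pow I - {{}}) id a) (neg_part (Pow I - {{}}) id a) q"

definition gen_permutahedra :: "'a set \<Rightarrow> ('a \<Rightarrow> real) set set" where
  "gen_permutahedra I = {q. \<exists>a. gp_coeffs I a q}"

text \<open>
  The coefficients at the non-empty subsets of \<open>I\<close> are determined by \<open>q\<close>: minimising the linear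
  functional \<open>x \<mapsto> \<Sum>i\<in>S. x i\<close> over \<open>q\<close> gives \<open>\<Sum>{a J |J. J \<subseteq> S}\<close>, which Moebius inversion solves
  for \<open>a\<close>. The values of \<open>a\<close> elsewhere are never used, so the choice made here is immaterial.
\<close>

definition some_coeffs :: "'a set \<Rightarrow> ('a \<Rightarrow> real) set \<Rightarrow> 'a set \<Rightarrow> real" where
  "some_coeffs I q = (SOME a. gp_coeffs I a q)"

definition gp_restrict :: "'a set \<Rightarrow> 'a set \<Rightarrow> ('a \<Rightarrow> real) set \<Rightarrow> ('a \<Rightarrow> real) set" where
  "gp_restrict A B q =
     (let a = some_coeffs (A \<union> B) q; \<J> = {J \<in> Pow (A \<union> B) - {{}}. \<not> J \<subseteq> B}
      in minkowski_diff (pos_part \<J> (\<lambda>J. J \<inter> A) a) (neg_part \<J> (\<lambda>J. J \<inter> A) a))"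

definition gp_contract :: "'a set \<Rightarrow> 'a set \<Rightarrow> ('a \<Rightarrow> real) set \<Rightarrow> ('a \<Rightarrow> real) set" where
  "gp_contract A B q =
     (let a = some_coeffs (A \<union> B) q; \<J> = {J \<in> Pow (A \<union> B) - {{}}. J \<subseteq> B}
      in minkowski_diff (pos_part \<J> id a) (neg_part \<J> id a))"

definition gp_product ::
  "'a set \<Rightarrow> 'a set \<Rightarrow> ('a \<Rightarrow> real) set \<Rightarrow> ('a \<Rightarrow> real) set \<Rightarrow> ('a \<Rightarrow> real) set" where
  "gp_product A B q\<^sub>1 q\<^sub>2 =
     {\<lambda>i. if i \<in> A then x i else if i \<in> B then y i else 0 |x y. x \<in> q\<^sub>1 \<and> y \<in> q\<^sub>2}"

definition gp_relabel :: "('a \<Rightarrow> 'a) \<Rightarrow> 'a set \<Rightarrow> ('a \<Rightarrow> real) set \<Rightarrow> ('a \<Rightarrow> real) set" where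
  "gp_relabel \<sigma> I q =
     (\<lambda>x. \<lambda>j. if j \<in> \<sigma> ` I then x (the_inv_into I \<sigma> j) else 0) ` q"

definition GP :: "('a, ('a \<Rightarrow> real) set, 'k::field_char_0) hopf_data" where
  "GP = \<lparr>
     basis = gen_permutahedra,
     act = (\<lambda>\<sigma> I. lin_ext (\<lambda>q. Poly_Mapping.single (gp_relabel \<sigma> I q) 1)),
     mult = (\<lambda>A B. lin_ext (\<lambda>(q\<^sub>1, q\<^sub>2). Poly_Mapping.single (gp_product A B q\<^sub>1 q\<^sub>2) 1)),
     comult = (\<lambda>A B. lin_ext (\<lambda>q. Poly_Mapping.single (gp_restrict A B q, gp_contract A B q) 1)),
     unit = Poly_Mapping.single {\<lambda>i. 0} 1,
     counit = lin_form (\<lambda>q. if q = {\<lambda>i. 0} then 1 else 0) \<rparr>"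

definition GP_character :: "'a set \<Rightarrow> (('a \<Rightarrow> real) set \<Rightarrow>\<^sub>0 'k::field_char_0) \<Rightarrow> 'k" where
  "GP_character I = lin_form (\<lambda>q. if (\<exists>x. q = {x}) then 1 else 0)"

end

theory Submission
  imports Defs
begin

text \<open>
  The coproduct of \<open>GP\<close> maps every basis vector to a basis vector, so it preserves the sum of the
  coefficients. For the chain \<open>x < y\<close> the coproduct of \<open>Pos\<close> vanishes in the order \<open>{x}, {y}\<close>, which
  forces the coefficients of the image of the chain to sum to \<open>0\<close>, and is a tensor of two points in
  the order \<open>{y}, {x}\<close>. In \<open>\<real>\<^sup>1\<close> every generalized permutahedron is a point, so there the
  coefficient sum agrees with the character, and the second order forces the sum \<open>1 \<cdot> 1\<close>.
\<close>

lemma lin_form_superset: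
  assumes "finite S" "Poly_Mapping.keys v \<subseteq> S"
  shows "lin_form f v = (\<Sum>b\<in>S. Poly_Mapping.lookup v b * f b)"
  unfolding lin_form_def
  by (rule sum.mono_neutral_left) (use assms in \<open>auto simp: in_keys_iff\<close>)

lemma lin_form_zero [simp]: "lin_form f 0 = 0"
  by (simp add: lin_form_def)

lemma lin_form_add: "lin_form f (u + v) = lin_form f u + lin_form f v"
proof -
  \<comment> \<open>Cancellation can make the keys of \<open>u + v\<close> a proper subset of this
    union, so all three sums are taken over one common index set.\<close>
  let ?S = "Poly_Mapping.keys u \<union> Poly_Mapping.keys v"
  have "Poly_Mapping.keys (u + v) \<subseteq> ?S"
    by (rule Poly_Mapping.keys_add)
  then show ?thesis
    by (simp add: lin_form_superset[of ?S] lookup_add sum.distrib distrib_right)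
qed

lemma lin_form_sum: "lin_form f (\<Sum>i\<in>S. v i) = (\<Sum>i\<in>S. lin_form f (v i))"
  by (induction S rule: infinite_finite_induct) (auto simp: lin_form_add)

lemma lin_form_single [simp]: "lin_form f (Poly_Mapping.single b c) = c * f b"
  by (cases "c = 0") (auto simp: lin_form_def)

lemma lookup_scale_vec [simp]: "Poly_Mapping.lookup (scale_vec c v) b = c * Poly_Mapping.lookup v b"
  unfolding scale_vec_def by (simp add: Poly_Mapping.map.rep_eq when_def)

lemma lin_form_scale_vec: "lin_form f (scale_vec c v) = c * lin_form f v"
proof -
  have "Poly_Mapping.keys (scale_vec c v) \<subseteq> Poly_Mapping.keys v"
    by (auto simp: in_keys_iff)
  then show ?thesis
    by (simp add: lin_form_superset[of "Poly_Mapping.keys v"] sum_distrib_left mult.assoc)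
qed

lemma lin_form_lin_ext: "lin_form f (lin_ext g v) = lin_form (\<lambda>b. lin_form f (g b)) v"
  by (simp add: lin_ext_def lin_form_sum lin_form_scale_vec) (simp add: lin_form_def)

text \<open>The constant weight does not see which pair carries a coefficient, so the double sum of
  products factors.\<close>

lemma lin_form_one_tensor:
  "lin_form (\<lambda>_. 1) (tensor u v) = lin_form (\<lambda>_. 1) u * lin_form (\<lambda>_. 1) v"
  by (simp add: tensor_def lin_form_sum) (simp add: lin_form_def sum_product)

lemma lin_ext_zero [simp]: "lin_ext f 0 = 0"
  by (simp add: lin_ext_def)

lemma lin_ext_single_one [simp]: "lin_ext f (Poly_Mapping.single b 1) = f b"
  by (auto simp: lin_ext_def intro!: poly_mapping_eqI)

text \<open>Whatever \<open>gp_restrict\<close> and \<open>gp_contract\<close> return, each basis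
  vector goes to a single basis vector with coefficient 1. The Minkowski differences behind them
  need no analysis.\<close>

lemma lin_form_one_comult_GP:
  "lin_form (\<lambda>_. 1) (comult GP A B v) = lin_form (\<lambda>_. 1) v"
  by (simp add: GP_def lin_form_lin_ext)

lemma sum_singleton_sets:
  assumes "\<And>i. i \<in> S \<Longrightarrow> \<exists>x. A i = {x}"
  shows "\<exists>x. (\<Sum>i\<in>S. A i) = {x :: 'a::comm_monoid_add}"
  using assms
proof (induction S rule: infinite_finite_induct)
  case (insert i S)
  then obtain x y where "A i = {x}" "(\<Sum>i\<in>S. A i) = {y}"
    by (metis insert_iff)
  with insert show ?case
    by (simp add: set_plus_def)
\<comment> \<open>Empty and infinite index sets both give the default sum \<open>0\<close>, which
  for sets is \<open>{0}\<close>, again a point.\<close>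
qed (auto simp: set_zero)

text \<open>The only simplex available is the vertex at \<open>i\<close>, so the positive and
  negative parts are both points, and a Minkowski difference of points is a point.\<close>

lemma gen_permutahedra_singleton:
  assumes "q \<in> gen_permutahedra {i}"
  shows "\<exists>x. q = {x}"
proof -
  obtain a where a: "gp_coeffs {i} a q"
    using assms by (auto simp: gen_permutahedra_def)
  let ?\<J> = "Pow {i} - {{}}"
  have point: "\<exists>x. dilate c (simplex_on (id J)) = {x}" if "J \<in> ?\<J>" for c J
  proof -
    have "J = {i}"
      using that by auto
    then show ?thesis
      by (simp add: simplex_on_def dilate_def)
  qed
  obtain p where p: "pos_part ?\<J> id a = {p}"
    using sum_singleton_sets[of "{J \<in> ?\<J>. a J > 0}" "\<lambda>J. dilate (a J) (simplex_on (id J))"] point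
    unfolding pos_part_def by blast
  obtain n where n: "neg_part ?\<J> id a = {n}"
    using sum_singleton_sets[of "{J \<in> ?\<J>. a J < 0}" "\<lambda>J. dilate \<bar>a J\<bar> (simplex_on (id J))"] point
    unfolding neg_part_def by blast
  have "{n} + q = {p}"
    using a p n by (simp add: gp_coeffs_def is_minkowski_diff_def)
  then have eq: "(+) n ` q = {p}"
    by (auto simp: set_plus_def image_def)
  \<comment> \<open>Adding the point \<open>n\<close> is a translation, and undoing it exhibits
    \<open>q\<close> as the image of the point \<open>p\<close>.\<close>
  have "q = (\<lambda>y. y - n) ` (+) n ` q"
    by (simp add: image_image)
  with eq show ?thesis
    by auto
qed

lemma GP_character_singleton:
  assumes "v \<in> vspace (basis GP {i})"
  shows "GP_character {i} v = lin_form (\<lambda>_. 1) v"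
  unfolding GP_character_def lin_form_def
proof (rule sum.cong)
  fix q assume "q \<in> Poly_Mapping.keys v"
  then have "\<exists>x. q = {x}"
    using assms by (intro gen_permutahedra_singleton) (auto simp: vspace_def GP_def)
  then show "Poly_Mapping.lookup v q * (if \<exists>x. q = {x} then 1 else 0) = Poly_Mapping.lookup v q * 1"
    by simp
qed simp

theorem corollary56:
  shows "\<not> (\<exists>\<phi> :: 'a::infinite set \<Rightarrow> ('a rel \<Rightarrow>\<^sub>0 'k::field_char_0) \<Rightarrow> (('a \<Rightarrow> real) set \<Rightarrow>\<^sub>0 'k).
           hopf_morphism Pos GP \<phi> \<and>
           (\<forall>I. finite I \<longrightarrow>
              (\<forall>v \<in> vspace (basis (Pos :: ('a, 'a rel, 'k) hopf_data) I).
                 GP_character I (\<phi> I v) = Pos_character I v)))"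
proof
  assume "\<exists>\<phi> :: 'a set \<Rightarrow> ('a rel \<Rightarrow>\<^sub>0 'k) \<Rightarrow> (('a \<Rightarrow> real) set \<Rightarrow>\<^sub>0 'k).
           hopf_morphism Pos GP \<phi> \<and>
           (\<forall>I. finite I \<longrightarrow>
              (\<forall>v \<in> vspace (basis (Pos :: ('a, 'a rel, 'k) hopf_data) I).
                 GP_character I (\<phi> I v) = Pos_character I v))"
  then obtain \<phi> :: "'a set \<Rightarrow> ('a rel \<Rightarrow>\<^sub>0 'k) \<Rightarrow> (('a \<Rightarrow> real) set \<Rightarrow>\<^sub>0 'k)"
    where mor: "hopf_morphism Pos GP \<phi>"
      and char: "\<And>I v. finite I \<Longrightarrow> v \<in> vspace (basis (Pos :: ('a, 'a rel, 'k) hopf_data) I) \<Longrightarrow>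
        GP_character I (\<phi> I v) = Pos_character I v"
    by blast
  have linear: "linear_between (vspace (basis (Pos :: ('a, 'a rel, 'k) hopf_data) I))
      (vspace (basis (GP :: ('a, ('a \<Rightarrow> real) set, 'k) hopf_data) I)) (\<phi> I)" if "finite I" for I
    using mor that by (simp add: hopf_morphism_def)
  have comult: "tensor_map (\<phi> A) (\<phi> B) (comult Pos A B v) = comult GP A B (\<phi> (A \<union> B) v)"
    if "finite A" "finite B" "A \<inter> B = {}"
      "v \<in> vspace (basis (Pos :: ('a, 'a rel, 'k) hopf_data) (A \<union> B))" for A B v
    using mor that by (simp add: hopf_morphism_def)
  \<comment> \<open>The one-element poset is an antichain, so its character is 1; in dimension one
    this value is also the coefficient sum of its image.\<close>
  have point: "lin_form (\<lambda>_. 1) (\<phi> {i} (Poly_Mapping.single {(i, i)} 1)) = 1" for i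
  proof -
    let ?v = "Poly_Mapping.single {(i, i)} 1 :: 'a rel \<Rightarrow>\<^sub>0 'k"
    have v: "?v \<in> vspace (basis (Pos :: ('a, 'a rel, 'k) hopf_data) {i})"
      by (auto simp: vspace_def Pos_def partial_order_on_def preorder_on_def refl_on_def
          trans_def antisym_def)
    then have "\<phi> {i} ?v \<in> vspace (basis (GP :: ('a, ('a \<Rightarrow> real) set, 'k) hopf_data) {i})"
      using linear[of "{i}"] by (simp add: linear_between_def)
    then have "lin_form (\<lambda>_. 1) (\<phi> {i} ?v) = Pos_character {i} ?v"
      using char[OF _ v] by (simp add: GP_character_singleton)
    also have "\<dots> = 1"
      by (simp add: Pos_character_def)
    finally show ?thesis .
  qed
  \<comment> \<open>A type with all elements equal lies in a singleton and would be finite.\<close>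
  obtain x y :: 'a where "x \<noteq> y"
    using infinite_UNIV by (metis (full_types) UNIV_I finite.simps finite_subset insertI1 subsetI)
  define chain where "chain = {(x, x), (x, y), (y, y)}"
  let ?c = "Poly_Mapping.single chain 1 :: 'a rel \<Rightarrow>\<^sub>0 'k"
  have c: "?c \<in> vspace (basis (Pos :: ('a, 'a rel, 'k) hopf_data) {x, y})"
    using \<open>x \<noteq> y\<close> by (auto simp: vspace_def Pos_def chain_def partial_order_on_def
        preorder_on_def refl_on_def trans_def antisym_def)
  \<comment> \<open>The left side does not depend on how \<open>{x, y}\<close> is split, so the two
    ordered splittings can be compared.\<close>
  have coeff_sum: "lin_form (\<lambda>_. 1) (\<phi> {x, y} ?c) =
      lin_form (\<lambda>_. 1) (tensor_map (\<phi> A) (\<phi> B) (comult Pos A B ?c))"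
    if "A \<union> B = {x, y}" "A \<inter> B = {}" for A B
  proof -
    have "finite (A \<union> B)"
      unfolding that(1) by simp
    then have "finite A" "finite B"
      by simp_all
    then have "tensor_map (\<phi> A) (\<phi> B) (comult Pos A B ?c) = comult GP A B (\<phi> {x, y} ?c)"
      using comult[of A B ?c] c that by simp
    then show ?thesis
      by (simp add: lin_form_one_comult_GP)
  qed
  have "lin_form (\<lambda>_. 1) (\<phi> {x, y} ?c) =
      lin_form (\<lambda>_. 1) (tensor_map (\<phi> {x}) (\<phi> {y}) (comult Pos {x} {y} ?c))"
    by (rule coeff_sum) (use \<open>x \<noteq> y\<close> in auto)
  \<comment> \<open>Ideals are upward closed here, and \<open>{x}\<close> misses \<open>y\<close>
    above \<open>x\<close>.\<close>
  also have "comult Pos {x} {y} ?c = 0"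
    using \<open>x \<noteq> y\<close> by (auto simp: Pos_def poset_ideal_def chain_def)
  finally have "lin_form (\<lambda>_. 1) (\<phi> {x, y} ?c) = 0"
    by (simp add: tensor_map_def)
  moreover have "lin_form (\<lambda>_. 1) (\<phi> {x, y} ?c) =
      lin_form (\<lambda>_. 1) (tensor_map (\<phi> {y}) (\<phi> {x}) (comult Pos {y} {x} ?c))"
    by (rule coeff_sum) (use \<open>x \<noteq> y\<close> in auto)
  \<comment> \<open>The top element alone is an ideal, and the chain restricts to a one-element
    poset on each side.\<close>
  moreover have "comult Pos {y} {x} ?c = Poly_Mapping.single ({(y, y)}, {(x, x)}) 1"
  proof -
    have "poset_ideal chain {y}" "chain \<inter> {y} \<times> {y} = {(y, y)}" "chain \<inter> {x} \<times> {x} = {(x, x)}"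
      using \<open>x \<noteq> y\<close> by (auto simp: poset_ideal_def chain_def)
    then show ?thesis
      by (simp add: Pos_def)
  qed
  ultimately show False
    by (simp add: tensor_map_def lin_form_one_tensor point)
qed

end
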